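(* Let $k,t,p,q$ be positive integers with $k \geq 2t$, $1 \leq p \leq 2t-1$ and $1 \leq q \leq k-2t+1$. Then $C_{p,q}$ is a submatrix of $A_{k,t}$.
   Context: For positive integers $k,t$ with $k\ge t$, $A_{k,t}$ is the $0,1$-matrix of size $\binom{k}{t}\times\binom{k}{t}$ whose rows and columns are indexed by all $t$-element subsets of $[k]=\{1,\dots,k\}$, with entry $1$ in row $x$, column $y$ if and only if $x\cap y\neq\emptyset$. For integers $p\ge 1$, $q\ge 0$ and $n=p+q$, $C_{p,q}$ is the $n\times n$ circulant $0,1$-matrix whose first column consists of $p$ ones followed by $q$ zeros and each subsequent column is the cyclic downward shift by one of the previous column; i.e. (indices $1,\dots,n$) the entry in row $i$, column $j$ is $1$ iff $(i-j) \bmod n \in\{0,1,\dots,p-1\}$. An $n\times m$ $0,1$-matrix $M$ is a submatrix of $A_{k,t}$ if there are distinct $t$-subsets $F_1,\dots,F_n$ of $[k]$ and distinct $t$-subsets $G_1,\dots,G_m$ of $[k]$ with $M_{ij}=1$ iff $F_i\cap G_j\ne\emptyset$. *)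

theory Defs
  imports "Jordan_Normal_Form.Matrix"
begin

definition t_subsets :: "nat \<Rightarrow> nat \<Rightarrow> nat set set" where
  "t_subsets k t = {x. x \<subseteq> {1..k} \<and> card x = t}"

text \<open>
  The matrix \<open>A\<^sub>k\<^sub>,\<^sub>t\<close> is indexed by sets, so it is not a value of type \<^typ>\<open>nat mat\<close>:
  its row and column index set is \<^term>\<open>t_subsets k t\<close> and its entries are given by
  \<open>A_entry\<close>. The parameters enter only through the index set.
\<close>

definition A_entry :: "nat set \<Rightarrow> nat set \<Rightarrow> nat" where
  "A_entry x y = (if x \<inter> y \<noteq> {} then 1 else 0)"

text \<open>
  The rows (and the columns) of a submatrix are pairwise distinct rows (columns) of
  \<open>A\<^sub>k\<^sub>,\<^sub>t\<close>, taken in any order.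
\<close>

definition submatrix_of_A :: "nat \<Rightarrow> nat \<Rightarrow> nat mat \<Rightarrow> bool" where
  "submatrix_of_A k t M \<longleftrightarrow>
    (\<exists>F G. F ` {..<dim_row M} \<subseteq> t_subsets k t \<and> inj_on F {..<dim_row M} \<and>
           G ` {..<dim_col M} \<subseteq> t_subsets k t \<and> inj_on G {..<dim_col M} \<and>
           (\<forall>i<dim_row M. \<forall>j<dim_col M. M $$ (i, j) = A_entry (F i) (G j)))"

text \<open>
  Indices of \<^typ>\<open>nat mat\<close> start at 0 rather than 1; this does not affect \<open>i - j\<close>, which is
  taken in the integers.
\<close>

definition circulant :: "nat \<Rightarrow> nat \<Rightarrow> nat mat" where
  "circulant p q = mat (p + q) (p + q)
    (\<lambda>(i, j). if (int i - int j) mod int (p + q) \<in> {0..int p - 1} then 1 else 0)"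

end

theory Submission
  imports Defs
begin

text \<open>
  Write \<open>p = a + b - 1\<close> with \<open>1 \<le> a, b \<le> t\<close> and put \<open>n = p + q\<close>. On the cycle of residues
  modulo \<open>n\<close>, the arc of length \<open>a\<close> ending at \<open>i\<close> meets the arc of length \<open>b\<close> starting at \<open>j\<close>
  iff \<open>(i - j) mod n \<in> {0..a + b - 2} = {0..p - 1}\<close>. All row arcs are padded to size \<open>t\<close> by the
  same \<open>t - a\<close> points outside the cycle, all column arcs by the same \<open>t - b\<close> further points. This
  takes \<open>n + (t - a) + (t - b) = 2 * t - 1 + q \<le> k\<close> points. Distinctness of the sets is inherited
  from distinctness of the rows and of the columns of the circulant.
\<close>

text \<open>An injective self-map of a finite set is a permutation, so preimages keep their size.
  With cyclic distance as \<open>f\<close> this gives the size of an arc.\<close>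

lemma card_filter_lessThan_inj:
  fixes f :: "nat \<Rightarrow> nat"
  assumes inj: "inj_on f {..<n}" and into: "f ` {..<n} \<subseteq> {..<n}" and "a \<le> n"
  shows "card {x. x < n \<and> f x < a} = a"
proof -
  have img: "f ` {..<n} = {..<n}"
    using inj into by (simp add: endo_inj_surj)
  have "f ` {x. x < n \<and> f x < a} = {..<a}"
  proof
    show "{..<a} \<subseteq> f ` {x. x < n \<and> f x < a}"
    proof
      fix y assume y: "y \<in> {..<a}"
      with \<open>a \<le> n\<close> have "y \<in> f ` {..<n}" by (simp add: img)
      with y show "y \<in> f ` {x. x < n \<and> f x < a}" by auto
    qed
  qed auto
  moreover have "inj_on f {x. x < n \<and> f x < a}"
    by (rule inj_on_subset[OF inj]) auto
  ultimately show ?thesis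
    by (metis card_image card_lessThan)
qed

text \<open>Measuring cyclic distance to the endpoint avoids a case split on wrap-around and allows
  any natural number as endpoint.\<close>

definition arc_to :: "nat \<Rightarrow> nat \<Rightarrow> nat \<Rightarrow> nat set" where
  "arc_to n a i = {x. x < n \<and> (int i - int x) mod int n < int a}"

definition arc_from :: "nat \<Rightarrow> nat \<Rightarrow> nat \<Rightarrow> nat set" where
  "arc_from n b j = {x. x < n \<and> (int x - int j) mod int n < int b}"

lemma int_diff_mod_eqD:
  fixes x y n :: nat
  assumes "int n dvd int x - int y" "x < n" "y < n"
  shows "x = y"
  using assms by (metis mod_eq_dvd_iff mod_less of_nat_eq_iff zmod_int)

lemma card_arc_to:
  assumes "a \<le> n"
  shows "card (arc_to n a i) = a"
proof -
  let ?f = "\<lambda>x. nat ((int i - int x) mod int n)"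
  have inj: "inj_on ?f {..<n}"
  proof (rule inj_onI)
    fix x y assume xy: "x \<in> {..<n}" "y \<in> {..<n}" and eq: "?f x = ?f y"
    then have "(int i - int x) mod int n = (int i - int y) mod int n"
      by (simp add: nat_eq_iff)
    then have "int n dvd int y - int x"
      by (simp add: mod_eq_dvd_iff)
    with xy show "x = y"
      using int_diff_mod_eqD[of n y x] by simp
  qed
  have into: "?f ` {..<n} \<subseteq> {..<n}"
    by (auto simp: nat_less_iff)
  have "arc_to n a i = {x. x < n \<and> ?f x < a}"
    by (auto simp: arc_to_def nat_less_iff)
  with card_filter_lessThan_inj[OF inj into assms] show ?thesis
    by simp
qed

lemma card_arc_from:
  assumes "b \<le> n"
  shows "card (arc_from n b j) = b"
proof -
  let ?f = "\<lambda>x. nat ((int x - int j) mod int n)"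
  have inj: "inj_on ?f {..<n}"
  proof (rule inj_onI)
    fix x y assume xy: "x \<in> {..<n}" "y \<in> {..<n}" and eq: "?f x = ?f y"
    then have "(int x - int j) mod int n = (int y - int j) mod int n"
      by (simp add: nat_eq_iff)
    then have "int n dvd int x - int y"
      by (simp add: mod_eq_dvd_iff)
    with xy show "x = y"
      using int_diff_mod_eqD[of n x y] by simp
  qed
  have into: "?f ` {..<n} \<subseteq> {..<n}"
    by (auto simp: nat_less_iff)
  have "arc_from n b j = {x. x < n \<and> ?f x < b}"
    by (auto simp: arc_from_def nat_less_iff)
  with card_filter_lessThan_inj[OF inj into assms] show ?thesis
    by simp
qed

text \<open>At a common point the two cyclic distances add up to \<open>i - j\<close> modulo
  \<open>n\<close>; conversely, a small enough residue of \<open>i - j\<close> splits into two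
  admissible distances.\<close>

lemma arcs_meet_iff:
  assumes "1 \<le> a" "1 \<le> b" "a + b \<le> n + 1" "0 < n"
  shows "arc_to n a i \<inter> arc_from n b j \<noteq> {} \<longleftrightarrow>
    (int i - int j) mod int n < int (a + b - 1)"
proof
  assume "arc_to n a i \<inter> arc_from n b j \<noteq> {}"
  then obtain x where u: "(int i - int x) mod int n < int a"
    and v: "(int x - int j) mod int n < int b"
    unfolding arc_to_def arc_from_def by blast
  let ?s = "(int i - int x) mod int n + (int x - int j) mod int n"
  \<comment> \<open>The sum is at most \<open>a + b - 2\<close>, hence below \<open>n\<close>: it is
    its own residue.\<close>
  have "0 \<le> ?s" "?s < int n" "?s < int (a + b - 1)"
    using u v assms by (simp_all add: add_nonneg_nonneg)
  moreover have "?s mod int n = (int i - int j) mod int n"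
    by (simp add: mod_add_eq)
  ultimately show "(int i - int j) mod int n < int (a + b - 1)"
    by simp
next
  let ?d = "(int i - int j) mod int n"
  assume d: "?d < int (a + b - 1)"
  have d0: "0 \<le> ?d" and dn: "?d < int n"
    using assms by simp_all
  \<comment> \<open>Greedy split: the column arc takes as much of the distance as it can, leaving at
    most \<open>a - 1\<close> for the row arc.\<close>
  define v where "v = min ?d (int b - 1)"
  have v: "0 \<le> v" "v < int b" "v < int n" "0 \<le> ?d - v" "?d - v < int a" "?d - v < int n"
    using d d0 dn assms by (auto simp: v_def min_def)
  define x where "x = nat ((int j + v) mod int n)"
  have x: "int x = (int j + v) mod int n"
    using assms by (simp add: x_def)
  have "x < n"
    using assms by (simp add: x_def nat_less_iff)
  moreover have "(int x - int j) mod int n = v"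
    using v by (simp add: x mod_diff_left_eq)
  moreover have "(int i - int x) mod int n = ?d - v"
  proof -
    have "(int i - int x) mod int n = (int i - int j - v) mod int n"
      by (simp add: x mod_diff_right_eq diff_diff_eq)
    also have "\<dots> = (?d - v) mod int n"
      by (simp add: mod_diff_left_eq)
    finally show ?thesis using v by simp
  qed
  ultimately have "x \<in> arc_to n a i \<inter> arc_from n b j"
    using v by (simp add: arc_to_def arc_from_def)
  then show "arc_to n a i \<inter> arc_from n b j \<noteq> {}" by blast
qed

text \<open>An arc of \<open>p\<close> residues, \<open>1 \<le> p < n\<close>, is determined by its first point: \<open>0\<close> and \<open>- 1\<close> are
  the two sides of its boundary.\<close>

lemma cyclic_boundary_unique:
  fixes d n p :: int
  assumes "d mod n < p" "\<not> (d - 1) mod n < p" "0 < n"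
  shows "d mod n = 0"
proof (rule ccontr)
  assume "d mod n \<noteq> 0"
  moreover have "0 \<le> d mod n" "d mod n < n"
    using assms by simp_all
  ultimately have "(d mod n - 1) mod n = d mod n - 1"
    by simp
  then have "(d - 1) mod n = d mod n - 1"
    by (simp add: mod_diff_left_eq)
  with assms show False by simp
qed

lemma minus_one_mod_not_less:
  fixes n p :: int
  assumes "p < n" "1 \<le> p"
  shows "\<not> (- 1) mod n < p"
  using assms by (simp add: zmod_minus1)

text \<open>Row \<open>i\<close> changes from one to zero between columns \<open>i\<close> and
  \<open>i + 1\<close>, cyclically. Row \<open>i'\<close> agrees there, and its only such change is
  at \<open>i'\<close>.\<close>

lemma circulant_row_inj:
  fixes i i' n :: nat and p :: int
  assumes "1 \<le> p" "p < int n" "i < n" "i' < n"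
    and eq: "\<And>j. j < n \<Longrightarrow> (int i - int j) mod int n < p \<longleftrightarrow> (int i' - int j) mod int n < p"
  shows "i = i'"
proof -
  have 1: "(int i' - int i) mod int n < p"
    using eq[of i] assms by simp
  define j where "j = Suc i mod n"
  have j: "int j = (int i + 1) mod int n"
    by (simp add: j_def zmod_int add.commute)
  have "(int i - int j) mod int n = (- 1) mod int n"
    by (simp add: j mod_diff_right_eq)
  moreover have "(int i' - int j) mod int n = (int i' - int i - 1) mod int n"
    by (simp add: j mod_diff_right_eq diff_diff_eq)
  ultimately have "\<not> (int i' - int i - 1) mod int n < p"
    using eq[of j] minus_one_mod_not_less[of p "int n"] assms by (simp add: j_def)
  from cyclic_boundary_unique[OF 1 this] assms
  show ?thesis using int_diff_mod_eqD[of n i' i] by (auto simp: mod_eq_0_iff_dvd)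
qed

lemma circulant_col_inj:
  fixes j j' n :: nat and p :: int
  assumes "1 \<le> p" "p < int n" "j < n" "j' < n"
    and eq: "\<And>i. i < n \<Longrightarrow> (int i - int j) mod int n < p \<longleftrightarrow> (int i - int j') mod int n < p"
  shows "j = j'"
proof -
  have 1: "(int j - int j') mod int n < p"
    using eq[of j] assms by simp
  \<comment> \<open>The row cyclically just before \<open>j\<close>: column \<open>j\<close> has its
    zero there and its first one in row \<open>j\<close>.\<close>
  define i where "i = nat ((int j - 1) mod int n)"
  have i: "int i = (int j - 1) mod int n"
    using assms by (simp add: i_def)
  have "i < n"
    using assms by (simp add: i_def nat_less_iff)
  have "(int i - int j) mod int n = (- 1) mod int n"
    by (simp add: i mod_diff_left_eq)
  moreover have "(int i - int j') mod int n = (int j - int j' - 1) mod int n"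
    by (simp add: i mod_diff_left_eq algebra_simps)
  ultimately have "\<not> (int j - int j' - 1) mod int n < p"
    using eq[OF \<open>i < n\<close>] minus_one_mod_not_less[of p "int n"] assms by simp
  from cyclic_boundary_unique[OF 1 this] assms
  show ?thesis using int_diff_mod_eqD[of n j j'] by (auto simp: mod_eq_0_iff_dvd)
qed

text \<open>\<open>Suc\<close> moves the 0-based points into \<open>{1..k}\<close>; the padding
  starts beyond the cycle, so sizes add.\<close>

lemma padded_in_t_subsets:
  assumes "S \<subseteq> {..<n}" "card S + (m' - m) = t" "n \<le> m" "m' \<le> k" "n \<le> k"
  shows "Suc ` (S \<union> {m..<m'}) \<in> t_subsets k t"
proof -
  have "finite S" "S \<inter> {m..<m'} = {}"
    using assms finite_subset by (auto dest: subsetD)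
  then have "card (Suc ` (S \<union> {m..<m'})) = t"
    using assms by (simp add: card_image card_Un_disjoint)
  moreover have "Suc ` (S \<union> {m..<m'}) \<subseteq> {1..k}"
    using assms by (auto dest: subsetD)
  ultimately show ?thesis by (simp add: t_subsets_def)
qed

theorem theorem1:
  fixes k t p q :: nat
  assumes "k \<ge> 1" and "t \<ge> 1"
    and "k \<ge> 2 * t"
    and "1 \<le> p" and "p \<le> 2 * t - 1"
    and "1 \<le> q" and "q \<le> k - 2 * t + 1"
  shows "submatrix_of_A k t (circulant p q)"
proof -
  \<comment> \<open>For \<open>p \<le> t\<close> this makes \<open>b = 1\<close>; otherwise
    \<open>a = t\<close>, and \<open>p \<le> 2 * t - 1\<close> gives
    \<open>b \<le> t\<close>.\<close>
  define a where "a = min p t"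
  define b where "b = p + 1 - a"
  define n where "n = p + q"
  define m where "m = n + (t - a)"
  define m' where "m' = m + (t - b)"
  have ab: "1 \<le> a" "1 \<le> b" "a \<le> t" "b \<le> t" "a + b = p + 1"
    and n: "a \<le> n" "b \<le> n" "0 < n" "p < n" and m: "n \<le> m" "m \<le> m'" "m' \<le> k"
    using assms by (auto simp: a_def b_def n_def m_def m'_def min_def)
  define F where "F i = Suc ` (arc_to n a i \<union> {n..<m})" for i
  define G where "G j = Suc ` (arc_from n b j \<union> {m..<m'})" for j
  have sub: "arc_to n a i \<subseteq> {..<n}" "arc_from n b j \<subseteq> {..<n}" for i j
    by (auto simp: arc_to_def arc_from_def)
  have FT: "F i \<in> t_subsets k t" for i
    unfolding F_def using sub(1) m ab n
    by (intro padded_in_t_subsets[where n = n]) (auto simp: card_arc_to m_def)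
  have GT: "G j \<in> t_subsets k t" for j
    unfolding G_def using sub(2) m ab n
    by (intro padded_in_t_subsets[where n = n]) (auto simp: card_arc_from m'_def)
  have meet: "F i \<inter> G j \<noteq> {} \<longleftrightarrow> (int i - int j) mod int n < int p" for i j
  proof -
    \<comment> \<open>The two padding blocks are disjoint from each other and from the cycle, so
      only the arcs can meet.\<close>
    have "F i \<inter> G j = Suc ` (arc_to n a i \<inter> arc_from n b j)"
      unfolding F_def G_def image_Int[OF inj_Suc, symmetric]
      using sub(1)[of i] sub(2)[of j] m by (fastforce dest: subsetD)
    then show ?thesis
      using arcs_meet_iff[of a b n i j] ab n by simp
  qed
  have "inj_on F {..<n}"
  proof (rule inj_onI)
    fix i i' assume "i \<in> {..<n}" "i' \<in> {..<n}" "F i = F i'"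
    then show "i = i'"
      \<comment> \<open>Equal sets meet the same \<open>G j\<close>, so the circulant rows agree;
        \<open>q \<ge> 1\<close> supplies \<open>p < n\<close>.\<close>
      using circulant_row_inj[of "int p" n i i'] meet[of i] meet[of i'] n assms by simp
  qed
  moreover have "inj_on G {..<n}"
  proof (rule inj_onI)
    fix j j' assume "j \<in> {..<n}" "j' \<in> {..<n}" "G j = G j'"
    then show "j = j'"
      using circulant_col_inj[of "int p" n j j'] meet[of _ j] meet[of _ j'] n assms by simp
  qed
  moreover have "circulant p q $$ (i, j) = A_entry (F i) (G j)" if "i < n" "j < n" for i j
    using that meet[of i j] n by (auto simp: circulant_def A_entry_def n_def)
  ultimately show ?thesis
    unfolding submatrix_of_A_def using FT GT
    by (intro exI[of _ F] exI[of _ G]) (auto simp: circulant_def n_def)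
qed

end
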